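(* Let $E\subseteq c_0$ be a non-zero symmetric sequence ideal. Suppose that $E$ is equipped with a Banach (i.e. complete) norm $\|\cdot\|_E$ such that the inclusion map $J:(E,\|\cdot\|_E)\to(c_0,\|\cdot\|_\infty)$ is continuous. Let $Z$ be a Banach space and let $Q:Z\to E$ be a bounded surjective linear operator. For $n\in\mathbb{N}$ let $\delta_n:E\to\mathbb{R}$ be defined by $\delta_n(x)=x_n$. Assume that there exists a closed subspace $M$ of $Z^*$ with the Schur property such that $Q^*\delta_n\in M$ for all $n\in\mathbb{N}$. Then $E=c_0$ as a set.
   Context: All vector spaces are real; sequences are indexed by $\mathbb{N}=\{1,2,\dots\}$. $c_0$ is the space of real sequences converging to $0$. For $x=(x_n)\in c_0$ the decreasing rearrangement $x^*=(x_n^* )$ is defined by $x_n^*=\inf_{F\subseteq\mathbb{N},\,|F|<n}\ \sup_{k\notin F}|x_k|$ for $n\in\mathbb{N}$. A linear subspace $E\subseteq c_0$ is called a symmetric sequence ideal if whenever $x\in E$, $y\in c_0$ and $y_n^*\le x_n^*$ for every $n$, then $y\in E$. A Banach space has the Schur property if every weakly convergent sequence in it converges in norm. $Q^*:E^*\to Z^*$ is the adjoint of $Q$ between the Banach duals; each $\delta_n$ belongs to $E^*$ because $J$ is continuous. *)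

theory Defs
  imports "HOL-Analysis.Analysis"
begin

(* Bounded real sequences with the supremum norm are the bounded continuous functions on the
   discrete space nat. Positions are counted from 0: the index n here is the index n + 1 of the
   convention in which sequences are indexed by 1, 2, ... *)

type_synonym bseq = "nat \<Rightarrow>\<^sub>C real"

definition c0 :: "bseq set" where
  "c0 = {x. apply_bcontfun x \<longlonglongrightarrow> 0}"

(* Since positions start at 0, "card F < n" becomes "card F < Suc n". The supremum is over a
   non-empty bounded set, and the infimum over a non-empty set bounded below by 0. *)

definition decr_rearr :: "bseq \<Rightarrow> nat \<Rightarrow> real" where
  "decr_rearr x n =
     (INF F\<in>{F. finite F \<and> card F < Suc n}. SUP k\<in>-F. \<bar>apply_bcontfun x k\<bar>)"

definition symmetric_sequence_ideal :: "bseq set \<Rightarrow> bool" where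
  "symmetric_sequence_ideal E \<longleftrightarrow>
     subspace E \<and> E \<subseteq> c0 \<and>
     (\<forall>x\<in>E. \<forall>y\<in>c0. (\<forall>n. decr_rearr y n \<le> decr_rearr x n) \<longrightarrow> y \<in> E)"

(* Norms on a linear subspace E are total functions of which only the values on E matter. *)

definition norm_on :: "'a::real_vector set \<Rightarrow> ('a \<Rightarrow> real) \<Rightarrow> bool" where
  "norm_on E N \<longleftrightarrow>
     (\<forall>x\<in>E. 0 \<le> N x) \<and>
     (\<forall>x\<in>E. N x = 0 \<longleftrightarrow> x = 0) \<and>
     (\<forall>a. \<forall>x\<in>E. N (a *\<^sub>R x) = \<bar>a\<bar> * N x) \<and>
     (\<forall>x\<in>E. \<forall>y\<in>E. N (x + y) \<le> N x + N y)"

(* The value 0 off E is needed because the locale Metric_space requires symmetry and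
   non-negativity of the distance function on the whole type. *)

definition norm_dist :: "'a::real_vector set \<Rightarrow> ('a \<Rightarrow> real) \<Rightarrow> 'a \<Rightarrow> 'a \<Rightarrow> real" where
  "norm_dist E N x y = (if x \<in> E \<and> y \<in> E then N (x - y) else 0)"

lemma Metric_space_norm_dist:
  assumes "subspace E" and "norm_on E N"
  shows "Metric_space E (norm_dist E N)"
proof (unfold_locales)
  have sub: "x - y \<in> E" if "x \<in> E" "y \<in> E" for x y
    using assms(1) that by (rule subspace_diff)
  note norm = assms(2)[unfolded norm_on_def, THEN conjunct1]
    assms(2)[unfolded norm_on_def, THEN conjunct2, THEN conjunct1]
    assms(2)[unfolded norm_on_def, THEN conjunct2, THEN conjunct2, THEN conjunct1]
    assms(2)[unfolded norm_on_def, THEN conjunct2, THEN conjunct2, THEN conjunct2]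
  have nn: "0 \<le> N x" if "x \<in> E" for x
    using that by (rule norm(1)[THEN bspec])
  have nz: "N x = 0 \<longleftrightarrow> x = 0" if "x \<in> E" for x
    using that by (rule norm(2)[THEN bspec])
  have ns: "N (a *\<^sub>R x) = \<bar>a\<bar> * N x" if "x \<in> E" for a x
    using that by (rule norm(3)[THEN spec, THEN bspec])
  have nt: "N (x + y) \<le> N x + N y" if "x \<in> E" "y \<in> E" for x y
    using that by (rule norm(4)[THEN bspec, THEN bspec])
  show "0 \<le> norm_dist E N x y" for x y
    unfolding norm_dist_def by (auto intro: nn sub)
  have comm: "N (x - y) = N (y - x)" if "x \<in> E" "y \<in> E" for x y
  proof -
    have "N (y - x) = N ((-1) *\<^sub>R (x - y))" by simp
    also have "\<dots> = N (x - y)" unfolding ns[OF sub[OF that]] by simp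
    finally show ?thesis by (rule sym)
  qed
  show "norm_dist E N x y = norm_dist E N y x" for x y
    unfolding norm_dist_def by (rule if_cong) (auto intro: comm)
  show "norm_dist E N x y = 0 \<longleftrightarrow> x = y" if "x \<in> E" "y \<in> E" for x y
    using nz[OF sub[OF that]] that by (simp add: norm_dist_def)
  show "norm_dist E N x z \<le> norm_dist E N x y + norm_dist E N y z"
    if "x \<in> E" "y \<in> E" "z \<in> E" for x y z
    using nt[OF sub[OF that(1,2)] sub[OF that(2,3)]] that by (simp add: norm_dist_def)
qed

definition banach_norm_on :: "'a::real_vector set \<Rightarrow> ('a \<Rightarrow> real) \<Rightarrow> bool" where
  "banach_norm_on E N \<longleftrightarrow> norm_on E N \<and> Metric_space.mcomplete E (norm_dist E N)"

definition continuous_inclusion :: "bseq set \<Rightarrow> (bseq \<Rightarrow> real) \<Rightarrow> bool" where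
  "continuous_inclusion E N \<longleftrightarrow>
     continuous_map (Metric_space.mtopology E (norm_dist E N)) (top_of_set c0) (\<lambda>x. x)"

definition bounded_linear_onto ::
    "('z::real_normed_vector \<Rightarrow> 'a::real_vector) \<Rightarrow> 'a set \<Rightarrow> ('a \<Rightarrow> real) \<Rightarrow> bool" where
  "bounded_linear_onto Q E N \<longleftrightarrow>
     linear Q \<and> range Q = E \<and> (\<exists>K. \<forall>z. N (Q z) \<le> K * norm z)"

definition coord :: "nat \<Rightarrow> bseq \<Rightarrow> real" where
  "coord n x = apply_bcontfun x n"

(* The functional \<phi> need only be defined, linear and bounded on the range of Q; Blinfun is
   meaningful because \<phi> \<circ> Q is then bounded and linear. *)

definition dual_adjoint ::
    "('z::real_normed_vector \<Rightarrow> 'a) \<Rightarrow> ('a \<Rightarrow> real) \<Rightarrow> ('z \<Rightarrow>\<^sub>L real)" where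
  "dual_adjoint Q \<phi> = Blinfun (\<phi> \<circ> Q)"

definition bounded_functionals_on :: "'a::real_normed_vector set \<Rightarrow> ('a \<Rightarrow> real) set" where
  "bounded_functionals_on M =
     {f. (\<forall>x\<in>M. \<forall>y\<in>M. f (x + y) = f x + f y) \<and>
         (\<forall>a. \<forall>x\<in>M. f (a *\<^sub>R x) = a * f x) \<and>
         (\<exists>K. \<forall>x\<in>M. \<bar>f x\<bar> \<le> K * norm x)}"

definition weakly_converges_in ::
    "'a::real_normed_vector set \<Rightarrow> (nat \<Rightarrow> 'a) \<Rightarrow> 'a \<Rightarrow> bool" where
  "weakly_converges_in M X x \<longleftrightarrow>
     range X \<subseteq> M \<and> x \<in> M \<and>
     (\<forall>f\<in>bounded_functionals_on M. (\<lambda>k. f (X k)) \<longlonglongrightarrow> f x)"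

definition schur_property :: "'a::real_normed_vector set \<Rightarrow> bool" where
  "schur_property M \<longleftrightarrow>
     (\<forall>X x. weakly_converges_in M X x \<longrightarrow> (\<exists>y\<in>M. X \<longlonglongrightarrow> y))"

end

theory Submission
  imports Defs
begin

text \<open>
  Continuity of the inclusion makes \<open>Q\<close> a bounded operator into \<open>c0\<close>, so the
  functionals \<open>x\<^sub>n = Q\<^sup>*\<delta>\<^sub>n\<close> tend to \<open>0\<close> pointwise on \<open>Z\<close>. The question
  is whether \<open>(x\<^sub>n)\<close> is weakly null in \<open>M\<close>.

  It cannot be. The Schur property would give a norm limit, which must be the pointwise limit
  \<open>0\<close>. But \<open>norm (x\<^sub>n)\<close> does not tend to \<open>0\<close>
  (\<open>coordinate_functionals_not_null\<close>): otherwise the entries of every element of \<open>E\<close>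
  along a suitable sequence of positions would decay at a prescribed rate, and by symmetry one
  can place there the entries of an element of \<open>E\<close> that decays more slowly.

  So some bounded functional \<open>f\<close> on \<open>M\<close> satisfies \<open>f (x\<^sub>n) \<ge> \<epsilon> > 0\<close>, after a
  change of sign, on an infinite set \<open>A\<close>. Then
  \<open>norm (\<Sum>n. a\<^sub>n x\<^sub>n) \<ge> c (\<Sum>n. a\<^sub>n)\<close> for all non-negative coefficients with finite
  support in \<open>A\<close>, and a minimax argument (\<open>finite_minimax\<close>) yields, for each finite
  \<open>F \<subseteq> A\<close>, a vector \<open>z\<close> of norm at most a fixed \<open>D\<close> for which \<open>Q z\<close> is at
  least \<open>1\<close> on all of \<open>F\<close> (\<open>uniformly_large_on_infinite_set\<close>). This is a
  one-sided form of the statement that \<open>(x\<^sub>n)\<close> has a subsequence equivalent to the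
  unit vectors of \<open>l\<^sup>1\<close>.

  A gliding hump (\<open>gliding_hump_domination\<close>) adds such vectors with geometrically
  decreasing coefficients \<open>r\<^sup>j\<close> over finite sets \<open>F\<^sub>j \<subseteq> A\<close> of any prescribed sizes. The sum
  has an image of order at least \<open>r\<^sup>j\<close> on \<open>F\<^sub>j\<close>. Since each \<open>y \<in> c0\<close> has only finitely many
  entries above each \<open>r\<^sup>j\<close>, the sizes can be chosen so that a rearrangement of \<open>y\<close> lies
  below this image, up to a constant factor; hence \<open>y \<in> E\<close>.
\<close>

section \<open>Comparison of decreasing rearrangements\<close>

text \<open>
  The preimage under \<open>p\<close> of a set removed from \<open>x\<close> can be removed from \<open>y\<close>: it has no
  more elements, and what is left of \<open>y\<close> is still dominated. The map \<open>p\<close> is constrained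
  only on the support of \<open>y\<close>, so that sequences can be spread out over arbitrary positions.
\<close>

lemma decr_rearr_le_of_inj_on:
  fixes x y :: bseq
  assumes inj: "inj_on p {k. apply_bcontfun y k \<noteq> 0}"
    and le: "\<And>k. apply_bcontfun y k \<noteq> 0 \<Longrightarrow> \<bar>apply_bcontfun y k\<bar> \<le> \<bar>apply_bcontfun x (p k)\<bar>"
  shows "decr_rearr y n \<le> decr_rearr x n"
proof -
  have bdd: "bdd_above ((\<lambda>k. \<bar>apply_bcontfun u k\<bar>) ` S)" for u :: bseq and S
    using norm_bounded[of u] by (intro bdd_aboveI2[where M = "norm u"]) simp
  have nonneg: "0 \<le> (SUP k\<in>-F. \<bar>apply_bcontfun u k\<bar>)" if fin: "finite F" for u :: bseq and F
  proof -
    obtain k where "k \<notin> F"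
      using ex_new_if_finite[OF infinite_UNIV_nat fin] by blast
    then show ?thesis
      by (intro cSUP_upper2[OF bdd, of k]) auto
  qed
  show ?thesis
    unfolding decr_rearr_def
  proof (rule cINF_mono)
    show "{F :: nat set. finite F \<and> card F < Suc n} \<noteq> {}"
      by (auto intro!: exI[of _ "{}"])
    show "bdd_below ((\<lambda>F. SUP k\<in>-F. \<bar>apply_bcontfun y k\<bar>) ` {F. finite F \<and> card F < Suc n})"
      by (rule bdd_belowI2[where m = 0]) (simp add: nonneg)
    fix F :: "nat set"
    assume "F \<in> {F. finite F \<and> card F < Suc n}"
    then have F: "finite F" "card F < Suc n"
      by auto
    define G where "G = {k. apply_bcontfun y k \<noteq> 0} \<inter> p -` F"
    have inj_G: "inj_on p G"
      using inj unfolding G_def by (rule inj_on_subset) auto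
    have pG: "p ` G \<subseteq> F"
      unfolding G_def by auto
    have "finite G"
      using finite_imageD[OF finite_subset[OF pG F(1)] inj_G] .
    moreover have "card G \<le> card F"
      by (rule card_inj_on_le[OF inj_G pG F(1)])
    moreover have "(SUP k\<in>-G. \<bar>apply_bcontfun y k\<bar>) \<le> (SUP k\<in>-F. \<bar>apply_bcontfun x k\<bar>)"
    proof (rule cSUP_least)
      show "- G \<noteq> {}"
        using ex_new_if_finite[OF infinite_UNIV_nat \<open>finite G\<close>] by blast
      fix k assume "k \<in> - G"
      show "\<bar>apply_bcontfun y k\<bar> \<le> (SUP k\<in>-F. \<bar>apply_bcontfun x k\<bar>)"
      proof (cases "apply_bcontfun y k = 0")
        case True
        then show ?thesis using nonneg[OF F(1)] by simp
      next
        case False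
        with \<open>k \<in> - G\<close> have "p k \<in> - F"
          by (auto simp: G_def)
        then show ?thesis
          by (rule cSUP_upper2[OF bdd]) (rule le[OF False])
      qed
    qed
    ultimately show "\<exists>G\<in>{F. finite F \<and> card F < Suc n}.
        (SUP k\<in>-G. \<bar>apply_bcontfun y k\<bar>) \<le> (SUP k\<in>-F. \<bar>apply_bcontfun x k\<bar>)"
      using F by (intro bexI[of _ G]) auto
  qed
qed

lemma symmetric_sequence_ideal_inj_on:
  assumes "symmetric_sequence_ideal E" and "x \<in> E" and "y \<in> c0"
    and "inj_on p {k. apply_bcontfun y k \<noteq> 0}"
    and "\<And>k. apply_bcontfun y k \<noteq> 0 \<Longrightarrow> \<bar>apply_bcontfun y k\<bar> \<le> \<bar>apply_bcontfun x (p k)\<bar>"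
  shows "y \<in> E"
proof -
  have "\<forall>n. decr_rearr y n \<le> decr_rearr x n"
    using decr_rearr_le_of_inj_on[OF assms(4,5)] by blast
  with assms(1-3) show ?thesis
    unfolding symmetric_sequence_ideal_def by blast
qed

lemma c0_of_tendsto:
  fixes y :: "nat \<Rightarrow> real"
  assumes "y \<longlonglongrightarrow> 0"
  obtains u where "u \<in> c0" and "apply_bcontfun u = y"
proof -
  have "y \<in> bcontfun"
    using convergent_imp_bounded[OF assms] by (simp add: bcontfun_def)
  then have "apply_bcontfun (Bcontfun y) = y"
    by (rule Bcontfun_inverse)
  with assms that[of "Bcontfun y"] show ?thesis
    by (simp add: c0_def)
qed

text \<open>Any non-zero entry of any element of \<open>E\<close>, rescaled and moved to position \<open>n\<close>, will do.\<close>

lemma unit_vector_in_symmetric_sequence_ideal: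
  assumes E: "symmetric_sequence_ideal E" and "E \<noteq> {0}"
  obtains u where "u \<in> E" and "apply_bcontfun u = (\<lambda>k. if k = n then 1 else 0)"
proof -
  have sub: "subspace E"
    using E by (simp add: symmetric_sequence_ideal_def)
  obtain v where v: "v \<in> E" "v \<noteq> 0"
    using subspace_0[OF sub] \<open>E \<noteq> {0}\<close> by blast
  obtain m where m: "apply_bcontfun v m \<noteq> 0"
    using v(2) by (metis bcontfun_eqI zero_bcontfun.rep_eq)
  have "(\<lambda>k. if k = n then 1 else 0 :: real) \<longlonglongrightarrow> 0"
    by (rule tendsto_eventually) (auto intro: eventually_mono[OF eventually_gt_at_top[of n]])
  then obtain u where u: "u \<in> c0" "apply_bcontfun u = (\<lambda>k. if k = n then 1 else 0)"
    by (rule c0_of_tendsto)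
  have "u \<in> E"
  proof (rule symmetric_sequence_ideal_inj_on[OF E _ u(1)])
    show "(1 / apply_bcontfun v m) *\<^sub>R v \<in> E"
      using subspace_scale[OF sub v(1)] .
    show "inj_on (\<lambda>_. m) {k. apply_bcontfun u k \<noteq> 0}"
      by (auto simp: u(2) inj_on_def)
    show "\<bar>apply_bcontfun u k\<bar> \<le> \<bar>apply_bcontfun ((1 / apply_bcontfun v m) *\<^sub>R v) m\<bar>" for k
      using m by (simp add: u(2))
  qed
  with u(2) that show ?thesis by blast
qed

section \<open>From continuity of the inclusion to a norm estimate\<close>

lemma continuous_inclusion_bounded:
  assumes sub: "subspace E" and N: "norm_on E N" and cont: "continuous_inclusion E N"
  obtains K where "0 < K" and "\<And>x. x \<in> E \<Longrightarrow> norm x \<le> K * N x"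
proof -
  interpret Metric_space E "norm_dist E N"
    by (rule Metric_space_norm_dist[OF sub N])
  have N0: "0 \<le> N x" and Nz: "N x = 0 \<longleftrightarrow> x = 0" and Ns: "N (a *\<^sub>R x) = \<bar>a\<bar> * N x"
    if "x \<in> E" for x a
    using N[unfolded norm_on_def] that by auto
  have zero: "0 \<in> E"
    using sub by (rule subspace_0)
  have "openin mtopology {x \<in> topspace mtopology. x \<in> c0 \<inter> ball 0 1}"
    using cont unfolding continuous_inclusion_def
    by (rule openin_continuous_map_preimage) (auto intro: openin_open_Int)
  moreover have "0 \<in> {x \<in> topspace mtopology. x \<in> c0 \<inter> ball 0 1}"
    using zero by (simp add: c0_def zero_bcontfun.rep_eq)
  ultimately obtain r where r: "r > 0" "mball 0 r \<subseteq> c0 \<inter> ball 0 1"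
    unfolding openin_mtopology by blast
  have "norm x \<le> (2 / r) * N x" if x: "x \<in> E" for x
  proof (cases "x = 0")
    case True
    then show ?thesis using N0[OF x] r by simp
  next
    case False
    then have pos: "N x > 0"
      using N0[OF x] Nz[OF x] by simp
    define a where "a = r / (2 * N x)"
    have a: "a > 0" using pos r by (simp add: a_def)
    have aE: "a *\<^sub>R x \<in> E" "- (a *\<^sub>R x) \<in> E"
      using subspace_scale[OF sub x, of a] subspace_neg[OF sub] by blast+
    have "N (- (a *\<^sub>R x)) = r / 2"
      using Ns[OF x, of "-a"] r(1) pos by (simp add: a_def)
    then have "a *\<^sub>R x \<in> mball 0 r"
      using zero aE r by (simp add: norm_dist_def)
    then have "norm (a *\<^sub>R x) < 1"
      using r(2) by (auto simp: subset_iff)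
    then show ?thesis
      using a pos r(1) by (simp add: a_def field_simps)
  qed
  with r(1) that[of "2 / r"] show ?thesis by simp
qed

section \<open>Functionals that are simultaneously large on finite sets\<close>

lemma square_positive_part_le:
  fixes u s :: real
  shows "(max 0 (u + s))\<^sup>2 \<le> (max 0 u)\<^sup>2 + 2 * max 0 u * s + s\<^sup>2"
proof -
  have "(max 0 (u + s))\<^sup>2 \<le> (max 0 u + s)\<^sup>2"
  proof (cases "u + s \<le> 0")
    case False
    then show ?thesis by (intro power_mono) auto
  qed simp
  then show ?thesis
    by (simp add: power2_eq_square algebra_simps)
qed

text \<open>
  If every convex combination of the functionals reaches \<open>c\<close> on the unit ball, then a single
  point of the ball brings all of them up to any \<open>c' < c\<close>. The
  proof minimises the total squared deficit \<open>d z = (\<Sum>n. (max 0 (c - x\<^sub>n z))\<^sup>2)\<close>. The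
  deficits at \<open>z\<close> themselves serve as weights: for them the hypothesis supplies a point
  \<open>w\<close>, and moving from \<open>z\<close> a fraction \<open>t\<close> of the way towards \<open>w\<close> lowers
  \<open>d z\<close> by \<open>2 t d z\<close> up to an error of order \<open>t\<^sup>2\<close>. Hence the infimum of the deficit
  is \<open>0\<close>, although it need not be attained.
\<close>

lemma finite_minimax:
  fixes x :: "'i \<Rightarrow> 'z::real_normed_vector \<Rightarrow>\<^sub>L real"
  assumes F: "finite F"
    and avg: "\<And>a. (\<And>n. n \<in> F \<Longrightarrow> 0 \<le> a n) \<Longrightarrow>
      \<exists>w. norm w \<le> 1 \<and> c * (\<Sum>n\<in>F. a n) \<le> (\<Sum>n\<in>F. a n * blinfun_apply (x n) w)"
    and "c' < c"
  shows "\<exists>z. norm z \<le> 1 \<and> (\<forall>n\<in>F. c' \<le> blinfun_apply (x n) z)"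
proof -
  define d where "d z = (\<Sum>n\<in>F. (max 0 (c - blinfun_apply (x n) z))\<^sup>2)" for z
  define \<delta> where "\<delta> = (INF z\<in>cball 0 1. d z)"
  define B where "B = (\<Sum>n\<in>F. (2 * norm (x n))\<^sup>2)"
  have d0: "0 \<le> d z" for z
    unfolding d_def by (intro sum_nonneg) simp
  have bdd: "bdd_below (d ` cball 0 1)"
    by (rule bdd_belowI2[where m = 0]) (rule d0)
  have step: "\<delta> \<le> (1 - 2 * t) * d z + t\<^sup>2 * B" if z: "norm z \<le> 1" and t: "0 \<le> t" "t \<le> 1" for z t
  proof -
    define a where "a n = max 0 (c - blinfun_apply (x n) z)" for n
    obtain w where w: "norm w \<le> 1"
      "c * (\<Sum>n\<in>F. a n) \<le> (\<Sum>n\<in>F. a n * blinfun_apply (x n) w)"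
      using avg[of a] by (auto simp: a_def)
    define v where "v = (1 - t) *\<^sub>R z + t *\<^sub>R w"
    have "norm v \<le> (1 - t) * norm z + t * norm w"
      unfolding v_def using norm_triangle_ineq[of "(1 - t) *\<^sub>R z" "t *\<^sub>R w"] t by simp
    also have "\<dots> \<le> (1 - t) * 1 + t * 1"
      using z w(1) t by (intro add_mono mult_left_mono) auto
    finally have "norm v \<le> 1" by simp
    then have "\<delta> \<le> d v"
      unfolding \<delta>_def by (intro cINF_lower[OF bdd]) simp
    also have "d v \<le> (\<Sum>n\<in>F. (a n)\<^sup>2
        + 2 * t * (a n * (blinfun_apply (x n) z - blinfun_apply (x n) w))
        + t\<^sup>2 * (2 * norm (x n))\<^sup>2)"
      unfolding d_def
    proof (rule sum_mono)
      fix n assume "n \<in> F"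
      define e where "e = blinfun_apply (x n) z - blinfun_apply (x n) w"
      have "\<bar>e\<bar> \<le> norm (x n) * norm (z - w)"
        using norm_blinfun[of "x n" "z - w"] by (simp add: e_def blinfun.diff_right)
      also have "\<dots> \<le> norm (x n) * 2"
        using norm_triangle_ineq4[of z w] z w(1) by (intro mult_left_mono) auto
      finally have "\<bar>e\<bar> \<le> \<bar>2 * norm (x n)\<bar>" by simp
      then have "e\<^sup>2 \<le> (2 * norm (x n))\<^sup>2" by (simp only: abs_le_square_iff)
      then have e2: "t\<^sup>2 * e\<^sup>2 \<le> t\<^sup>2 * (2 * norm (x n))\<^sup>2"
        by (rule mult_left_mono) simp
      have "c - blinfun_apply (x n) v = (c - blinfun_apply (x n) z) + t * e"
        by (simp add: v_def e_def blinfun.add_right blinfun.scaleR_right) (simp add: algebra_simps)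
      then have "(max 0 (c - blinfun_apply (x n) v))\<^sup>2 \<le> (a n)\<^sup>2 + 2 * a n * (t * e) + (t * e)\<^sup>2"
        unfolding a_def by (simp only: square_positive_part_le)
      also have "\<dots> = (a n)\<^sup>2 + 2 * t * (a n * e) + t\<^sup>2 * e\<^sup>2"
        by (simp add: power_mult_distrib)
      finally show "(max 0 (c - blinfun_apply (x n) v))\<^sup>2 \<le> (a n)\<^sup>2
          + 2 * t * (a n * (blinfun_apply (x n) z - blinfun_apply (x n) w))
          + t\<^sup>2 * (2 * norm (x n))\<^sup>2"
        using e2 unfolding e_def by linarith
    qed
    also have "\<dots> = d z + 2 * t * ((\<Sum>n\<in>F. a n * blinfun_apply (x n) z)
        - (\<Sum>n\<in>F. a n * blinfun_apply (x n) w)) + t\<^sup>2 * B"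
      by (simp add: d_def a_def B_def sum.distrib sum_distrib_left sum_subtractf right_diff_distrib)
    also have "\<dots> \<le> d z + 2 * t * (- d z) + t\<^sup>2 * B"
    proof -
      have "(\<Sum>n\<in>F. a n * blinfun_apply (x n) z) - c * (\<Sum>n\<in>F. a n) = - d z"
      proof -
        have "(a n)\<^sup>2 = a n * (c - blinfun_apply (x n) z)" for n
          by (simp add: a_def max_def power2_eq_square)
        then have "d z = (\<Sum>n\<in>F. a n * (c - blinfun_apply (x n) z))"
          by (simp add: d_def a_def[symmetric])
        then show ?thesis
          by (simp add: right_diff_distrib sum_subtractf sum_distrib_left mult.commute)
      qed
      then show ?thesis
        using w(2) t(1) by (intro add_right_mono add_left_mono mult_left_mono) auto
    qed
    finally show ?thesis by (simp add: algebra_simps)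
  qed
  \<comment> \<open>The infimum of the right-hand side of \<open>step\<close> over \<open>z\<close> bounds \<open>\<delta>\<close>; then \<open>t\<close> tends to \<open>0\<close>.\<close>
  have "\<delta> \<le> 0"
  proof -
    have half: "2 * t * \<delta> \<le> t\<^sup>2 * B" if t: "0 \<le> t" "t < 1/2" for t
    proof -
      have pos: "0 < 1 - 2 * t" using t by simp
      have "(\<delta> - t\<^sup>2 * B) / (1 - 2 * t) \<le> d z" if "z \<in> cball 0 1" for z
        using step[of z t] t that pos by (simp add: pos_divide_le_eq mult.commute)
      then have "(\<delta> - t\<^sup>2 * B) / (1 - 2 * t) \<le> \<delta>"
        unfolding \<delta>_def by (intro cINF_greatest) auto
      then show ?thesis using pos by (simp add: pos_divide_le_eq algebra_simps)
    qed
    show ?thesis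
    proof (rule ccontr)
      assume "\<not> \<delta> \<le> 0"
      then have \<delta>: "\<delta> > 0" by simp
      have B0: "0 \<le> B" unfolding B_def by (intro sum_nonneg) simp
      \<comment> \<open>Small enough that \<open>t B \<le> \<delta>\<close>, which contradicts \<open>2 \<delta> \<le> t B\<close>.\<close>
      define t where "t = min (1/3) (\<delta> / (B + 1))"
      have t: "0 < t" "t < 1/2" "t \<le> \<delta> / (B + 1)"
        using \<delta> B0 by (auto simp: t_def)
      have "t * B \<le> t * (B + 1)" using t(1) by simp
      also have "\<dots> \<le> \<delta>" using t(3) B0 by (simp add: pos_le_divide_eq)
      finally have "t\<^sup>2 * B \<le> t * \<delta>"
        using t(1) by (simp add: power2_eq_square mult.assoc)
      moreover have "2 * t * \<delta> \<le> t\<^sup>2 * B" using half t by simp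
      ultimately have "t * \<delta> \<le> 0" by simp
      then show False using t(1) \<delta> by (simp add: mult_le_0_iff)
    qed
  qed
  then have "(INF z\<in>cball 0 1. d z) < (c - c')\<^sup>2"
    unfolding \<delta>_def[symmetric] using \<open>c' < c\<close> by (smt (verit) zero_less_power2)
  then obtain z where z: "norm z \<le> 1" "d z < (c - c')\<^sup>2"
    using cINF_less_iff[OF _ bdd] by auto
  have "c' \<le> blinfun_apply (x n) z" if n: "n \<in> F" for n
  proof -
    have "(max 0 (c - blinfun_apply (x n) z))\<^sup>2 \<le> d z"
      unfolding d_def by (rule member_le_sum[OF n _ F]) simp
    then have "(max 0 (c - blinfun_apply (x n) z))\<^sup>2 < (c - c')\<^sup>2"
      using z(2) by simp
    then have "max 0 (c - blinfun_apply (x n) z) < c - c'"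
      by (rule power_less_imp_less_base) (use \<open>c' < c\<close> in simp)
    then show ?thesis by simp
  qed
  with z(1) show ?thesis by blast
qed

text \<open>The norm need not be attained on the unit ball, but half of it always is.\<close>

lemma blinfun_half_norming:
  fixes f :: "'z::real_normed_vector \<Rightarrow>\<^sub>L real"
  obtains w where "norm w \<le> 1" and "norm f \<le> 2 * blinfun_apply f w"
proof (rule ccontr)
  assume "\<not> thesis"
  then have small: "2 * blinfun_apply f w < norm f" if "norm w \<le> 1" for w
    using that \<open>\<And>w. norm w \<le> 1 \<Longrightarrow> norm f \<le> 2 * blinfun_apply f w \<Longrightarrow> thesis\<close> by force
  have "norm (blinfun_apply f w) \<le> norm f / 2 * norm w" for w
  proof (cases "w = 0")
    case False
    have "2 * blinfun_apply f (sgn w) < norm f" "2 * blinfun_apply f (- sgn w) < norm f"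
      by (intro small; simp add: norm_sgn)+
    then have "\<bar>blinfun_apply f (sgn w)\<bar> \<le> norm f / 2"
      by (auto simp: blinfun.minus_right)
    then have "norm w * \<bar>blinfun_apply f (sgn w)\<bar> \<le> norm w * (norm f / 2)"
      by (rule mult_left_mono) simp
    moreover have "w = norm w *\<^sub>R sgn w"
      using False by (simp add: sgn_div_norm)
    then have "blinfun_apply f w = norm w * blinfun_apply f (sgn w)"
      by (metis blinfun.scaleR_right real_scaleR_def)
    ultimately show ?thesis
      by (simp add: abs_mult mult.commute)
  qed simp
  then have "norm f \<le> norm f / 2"
    by (intro norm_blinfun_bound) auto
  then have "norm f \<le> 0" by simp
  then show False using small[of 0] by simp
qed

lemma bounded_functionals_on_uminus:
  "f \<in> bounded_functionals_on M \<Longrightarrow> (\<lambda>x. - f x) \<in> bounded_functionals_on M"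
  by (auto simp: bounded_functionals_on_def)

lemma bounded_functionals_on_sum:
  assumes f: "f \<in> bounded_functionals_on M" and M: "subspace M"
    and x: "\<And>n. n \<in> F \<Longrightarrow> x n \<in> M"
  shows "f (\<Sum>n\<in>F. a n *\<^sub>R x n) = (\<Sum>n\<in>F. a n * f (x n))"
proof -
  have add: "f (u + v) = f u + f v" and scale: "f (b *\<^sub>R u) = b * f u"
    if "u \<in> M" "v \<in> M" for u v b
    using f that by (auto simp: bounded_functionals_on_def)
  have zero: "f 0 = 0"
    using scale[of 0 0 0] subspace_0[OF M] by simp
  show ?thesis
    using x
  proof (induction F rule: infinite_finite_induct)
    case (insert n F)
    have "a n *\<^sub>R x n \<in> M" "(\<Sum>n\<in>F. a n *\<^sub>R x n) \<in> M"
      using insert.prems by (auto intro!: subspace_scale[OF M] subspace_sum[OF M])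
    with insert show ?case
      by (simp add: add scale)
  qed (simp_all add: zero)
qed

text \<open>
  The functional \<open>f\<close> bounds \<open>norm (\<Sum>n\<in>F. a n *\<^sub>R x n)\<close> below by a multiple of
  \<open>\<Sum>n\<in>F. a n\<close> for non-negative \<open>a\<close>, and a vector that half attains this norm verifies
  the hypothesis of \<open>finite_minimax\<close>. As in Helly's theorem, a functional on the dual is
  replaced by vectors of the space, here with a bound \<open>D\<close> independent of \<open>F\<close>.
\<close>

lemma uniformly_large_on_infinite_set:
  fixes x :: "nat \<Rightarrow> 'z::real_normed_vector \<Rightarrow>\<^sub>L real"
  assumes M: "subspace M" and x: "\<And>n. x n \<in> M"
    and f: "f \<in> bounded_functionals_on M" and not_null: "\<not> (\<lambda>n. f (x n)) \<longlonglongrightarrow> 0"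
  obtains A D where "infinite A"
    and "\<And>F. finite F \<Longrightarrow> F \<subseteq> A \<Longrightarrow> \<exists>z. norm z \<le> D \<and> (\<forall>n\<in>F. 1 \<le> blinfun_apply (x n) z)"
proof -
  obtain \<epsilon> where \<epsilon>: "\<epsilon> > 0" "infinite {n. \<epsilon> \<le> \<bar>f (x n)\<bar>}"
    using not_null
    by (auto simp: tendsto_iff cofinite_eq_sequentially[symmetric] eventually_cofinite not_less)
  have "{n. \<epsilon> \<le> \<bar>f (x n)\<bar>} \<subseteq> {n. \<epsilon> \<le> f (x n)} \<union> {n. \<epsilon> \<le> - f (x n)}"
    by auto
  with \<epsilon>(2) have "infinite {n. \<epsilon> \<le> f (x n)} \<or> infinite {n. \<epsilon> \<le> - f (x n)}"
    by (meson finite_UnI finite_subset)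
  then obtain g where g: "g \<in> bounded_functionals_on M" and inf: "infinite {n. \<epsilon> \<le> g (x n)}"
    using f bounded_functionals_on_uminus[OF f] by blast
  obtain K where K: "\<And>v. v \<in> M \<Longrightarrow> \<bar>g v\<bar> \<le> K * norm v"
    using g unfolding bounded_functionals_on_def by blast
  define L where "L = max 1 K"
  have L: "L > 0" "\<And>v. v \<in> M \<Longrightarrow> \<bar>g v\<bar> \<le> L * norm v"
  proof -
    show "0 < L" by (simp add: L_def)
    fix v assume "v \<in> M"
    then have "\<bar>g v\<bar> \<le> K * norm v" by (rule K)
    also have "\<dots> \<le> L * norm v" by (intro mult_right_mono) (auto simp: L_def)
    finally show "\<bar>g v\<bar> \<le> L * norm v" .
  qed
  define c where "c = \<epsilon> / (2 * L)"
  have c: "c > 0" using \<epsilon>(1) L(1) by (simp add: c_def)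
  have "\<exists>z. norm z \<le> 2 / c \<and> (\<forall>n\<in>F. 1 \<le> blinfun_apply (x n) z)"
    if F: "finite F" "F \<subseteq> {n. \<epsilon> \<le> g (x n)}" for F
  proof -
    have "\<exists>z. norm z \<le> 1 \<and> (\<forall>n\<in>F. c / 2 \<le> blinfun_apply (x n) z)"
    proof (rule finite_minimax[OF F(1), where c = c])
      fix a :: "nat \<Rightarrow> real"
      assume a: "\<And>n. n \<in> F \<Longrightarrow> 0 \<le> a n"
      define v where "v = (\<Sum>n\<in>F. a n *\<^sub>R x n)"
      have v: "v \<in> M"
        unfolding v_def by (intro subspace_sum subspace_scale M x)
      have "\<epsilon> * (\<Sum>n\<in>F. a n) = (\<Sum>n\<in>F. a n * \<epsilon>)"
        by (simp add: sum_distrib_left mult.commute)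
      also have "\<dots> \<le> (\<Sum>n\<in>F. a n * g (x n))"
        using a F(2) by (intro sum_mono mult_left_mono) auto
      also have "\<dots> = g v"
        unfolding v_def by (rule bounded_functionals_on_sum[OF g M x, symmetric])
      also have "\<dots> \<le> L * norm v"
        using L(2)[OF v] by simp
      finally have bound: "\<epsilon> * (\<Sum>n\<in>F. a n) \<le> L * norm v" .
      obtain w where w: "norm w \<le> 1" "norm v \<le> 2 * blinfun_apply v w"
        by (rule blinfun_half_norming)
      have "\<epsilon> * (\<Sum>n\<in>F. a n) \<le> L * (2 * blinfun_apply v w)"
        using bound mult_left_mono[OF w(2) less_imp_le[OF L(1)]] by (rule order_trans)
      then have "c * (\<Sum>n\<in>F. a n) \<le> blinfun_apply v w"
        using L(1) by (simp add: c_def field_simps)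
      also have "\<dots> = (\<Sum>n\<in>F. a n * blinfun_apply (x n) w)"
        by (simp add: v_def blinfun.sum_left blinfun.scaleR_left)
      finally show "\<exists>w. norm w \<le> 1
          \<and> c * (\<Sum>n\<in>F. a n) \<le> (\<Sum>n\<in>F. a n * blinfun_apply (x n) w)"
        using w(1) by blast
    qed (use c in simp)
    then obtain z where z: "norm z \<le> 1" "\<And>n. n \<in> F \<Longrightarrow> c / 2 \<le> blinfun_apply (x n) z"
      by blast
    show ?thesis
    proof (intro exI[of _ "(2 / c) *\<^sub>R z"] conjI ballI)
      show "norm ((2 / c) *\<^sub>R z) \<le> 2 / c"
        using z(1) c by (simp add: field_simps)
      show "1 \<le> blinfun_apply (x n) ((2 / c) *\<^sub>R z)" if "n \<in> F" for n
        using z(2)[OF that] c by (simp add: blinfun.scaleR_right field_simps)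
    qed
  qed
  with inf show ?thesis by (rule that)
qed

section \<open>The gliding hump\<close>

lemma c0_finite_large:
  assumes "y \<in> c0" and "0 < e"
  shows "finite {k. e \<le> \<bar>apply_bcontfun y k\<bar>}"
  using assms
  by (auto simp: c0_def tendsto_iff cofinite_eq_sequentially[symmetric] eventually_cofinite not_less)

text \<open>
  The images supplied for different finite sets may overlap and cancel each other. The sets
  \<open>F j\<close> are therefore chosen one after the other, each so far out that the partial sum built before it is at most \<open>r ^ j / 4\<close>
  there, while \<open>r\<close> is so small that the whole remainder of the series contributes at most
  another \<open>r ^ j / 4\<close>.
\<close>

lemma gliding_hump_domination:
  fixes Q :: "'z::banach \<Rightarrow> bseq"
  assumes Q: "bounded_linear Q" and range: "\<And>z. Q z \<in> c0"
    and A: "infinite A"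
    and large: "\<And>F. finite F \<Longrightarrow> F \<subseteq> A \<Longrightarrow>
      \<exists>z. norm z \<le> D \<and> (\<forall>n\<in>F. 1 \<le> apply_bcontfun (Q z) n)"
    and y: "y \<in> c0" "norm y \<le> 1 / 2"
  obtains z p where "inj_on p {k. apply_bcontfun y k \<noteq> 0}"
    and "\<And>k. apply_bcontfun y k \<noteq> 0 \<Longrightarrow> \<bar>apply_bcontfun y k\<bar> \<le> \<bar>apply_bcontfun (Q z) (p k)\<bar>"
proof -
  interpret Q: bounded_linear Q by (rule Q)
  obtain C where C: "C > 0" "\<And>z. norm (Q z) \<le> norm z * C"
    using Q.pos_bounded by blast
  have coord_bound: "\<bar>apply_bcontfun (Q z) n\<bar> \<le> norm z * C" for z n
    using norm_bounded[of "Q z" n] C(2)[of z] by simp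
  have D: "0 \<le> D"
    using large[of "{}"] norm_ge_zero order_trans by blast
  \<comment> \<open>Chosen such that \<open>C D r / (1 - r) \<le> 1 / 4\<close> and \<open>r < 1\<close>, even if \<open>D = 0\<close>.\<close>
  define r where "r = 1 / (2 + 4 * C * D)"
  have CD: "0 \<le> C * D" using C(1) D by simp
  have r: "0 < r" "r < 1"
    using CD by (auto simp: r_def)
  have r_tail: "C * (D * (r / (1 - r))) \<le> 1 / 4"
  proof -
    have "1 - r = (1 + 4 * C * D) / (2 + 4 * C * D)"
      using CD by (simp add: r_def field_simps)
    then have "r / (1 - r) = 1 / (1 + 4 * C * D)"
      using CD by (simp add: r_def)
    then have "C * (D * (r / (1 - r))) = C * D / (1 + 4 * (C * D))"
      by (simp add: mult.assoc)
    also have "\<dots> \<le> 1 / 4"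
      using CD by (simp add: pos_divide_le_eq)
    finally show ?thesis .
  qed
  define B where "B j = {k. r ^ Suc j / 2 \<le> \<bar>apply_bcontfun y k\<bar>}" for j
  have B: "finite (B j)" for j
    unfolding B_def using r by (intro c0_finite_large[OF y(1)]) simp

  \<comment> \<open>A state consists of the partial sum of the first \<open>j\<close> terms and of a position from which
     this sum is negligible and beyond all sets used so far.\<close>
  define P where "P j s \<longleftrightarrow> (\<forall>n\<ge>snd s. \<bar>apply_bcontfun (Q (fst s)) n\<bar> \<le> r ^ j / 4)"
    for j and s :: "'z \<times> nat"
  define R where "R j s t \<longleftrightarrow> snd s \<le> snd t \<and> norm (fst t - fst s) \<le> D * r ^ j \<and>
      (\<exists>F. finite F \<and> F \<subseteq> {snd s..<snd t} \<and> card F = card (B j) \<and>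
        (\<forall>n\<in>F. r ^ j \<le> apply_bcontfun (Q (fst t - fst s)) n))" for j and s t :: "'z \<times> nat"
  have "\<exists>s. \<forall>j. P j (s j) \<and> R j (s j) (s (Suc j))"
  proof (rule dependent_nat_choice)
    show "\<exists>s. P 0 s"
      by (rule exI[of _ "(0, 0)"]) (simp add: P_def Q.zero)
  next
    fix s j assume "P j s"
    have "infinite (A - {..<snd s})"
      using A by simp
    then obtain F where F: "finite F" "card F = card (B j)" "F \<subseteq> A - {..<snd s}"
      using infinite_arbitrarily_large by blast
    obtain w where w: "norm w \<le> D" "\<And>n. n \<in> F \<Longrightarrow> 1 \<le> apply_bcontfun (Q w) n"
      using large[OF F(1)] F(3) by blast
    define u where "u = fst s + r ^ j *\<^sub>R w"
    have "finite {k. r ^ Suc j / 4 \<le> \<bar>apply_bcontfun (Q u) k\<bar>}"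
      using r by (intro c0_finite_large[OF range]) simp
    then have "finite (F \<union> {k. r ^ Suc j / 4 \<le> \<bar>apply_bcontfun (Q u) k\<bar>})"
      using F(1) by simp
    then obtain b where b: "\<And>n. n \<in> F \<union> {k. r ^ Suc j / 4 \<le> \<bar>apply_bcontfun (Q u) k\<bar>} \<Longrightarrow> n < b"
      using finite_nat_set_iff_bounded[THEN iffD1] by metis
    show "\<exists>t. P (Suc j) t \<and> R j s t"
    proof (intro exI[of _ "(u, max (snd s) b)"] conjI)
      show "P (Suc j) (u, max (snd s) b)"
        unfolding P_def
      proof (intro allI impI)
        fix n assume "snd (u, max (snd s) b) \<le> n"
        then have "\<not> n < b" by simp
        then have "\<not> r ^ Suc j / 4 \<le> \<bar>apply_bcontfun (Q u) n\<bar>" using b by blast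
        then show "\<bar>apply_bcontfun (Q (fst (u, max (snd s) b))) n\<bar> \<le> r ^ Suc j / 4" by simp
      qed
      have "norm (r ^ j *\<^sub>R w) \<le> D * r ^ j"
        using w(1) r by (simp add: mult.commute mult_left_mono)
      moreover have "F \<subseteq> {snd s..<max (snd s) b}"
      proof
        fix n assume "n \<in> F"
        then have "n < b" "\<not> n < snd s" using b F(3) by auto
        then show "n \<in> {snd s..<max (snd s) b}" by auto
      qed
      moreover have "r ^ j \<le> apply_bcontfun (Q (r ^ j *\<^sub>R w)) n" if "n \<in> F" for n
        using w(2)[OF that] r by (simp add: Q.scaleR)
      ultimately show "R j s (u, max (snd s) b)"
        unfolding R_def using F(1,2) by (auto simp: u_def intro!: exI[of _ F])
    qed
  qed
  then obtain s where s: "\<And>j. P j (s j)" "\<And>j. R j (s j) (s (Suc j))"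
    by blast
  define u where "u j = fst (s j)" for j
  define m where "m j = snd (s j)" for j
  have u_early: "\<bar>apply_bcontfun (Q (u j)) n\<bar> \<le> r ^ j / 4" if "m j \<le> n" for j n
    using s(1)[of j] that by (simp add: P_def u_def m_def)
  have m_Suc: "m j \<le> m (Suc j)" and u_Suc: "norm (u (Suc j) - u j) \<le> D * r ^ j" for j
    using s(2)[of j] by (auto simp: R_def u_def m_def)
  have "\<exists>F. finite F \<and> F \<subseteq> {m j..<m (Suc j)} \<and> card F = card (B j) \<and>
      (\<forall>n\<in>F. r ^ j \<le> apply_bcontfun (Q (u (Suc j) - u j)) n)" for j
    using s(2)[of j] by (simp add: R_def u_def m_def)
  then obtain F where F: "\<And>j. finite (F j)" "\<And>j. F j \<subseteq> {m j..<m (Suc j)}"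
    "\<And>j. card (F j) = card (B j)"
    "\<And>j n. n \<in> F j \<Longrightarrow> r ^ j \<le> apply_bcontfun (Q (u (Suc j) - u j)) n"
    by metis
  have m_mono: "m i \<le> m j" if "i \<le> j" for i j
    using lift_Suc_mono_le[of m, OF m_Suc that] .
  have F_disj: "i = j" if "n \<in> F i" "n \<in> F j" for i j n
  proof -
    have "m i \<le> n" "n < m (Suc i)" "m j \<le> n" "n < m (Suc j)"
      using F(2)[of i] F(2)[of j] that by auto
    then have "\<not> Suc i \<le> j" "\<not> Suc j \<le> i"
      using m_mono[of "Suc i" j] m_mono[of "Suc j" i] by auto
    then show ?thesis by simp
  qed

  define d where "d i = u (Suc i) - u i" for i
  have geo: "(\<lambda>i. D * r ^ (i + k)) sums (D * (r ^ k / (1 - r)))" for k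
    using sums_mult[OF sums_mult2[OF geometric_sums[of r], of "r ^ k"], of D] r
    by (simp add: power_add)
  have d: "norm (d i) \<le> D * r ^ i" for i
    using u_Suc by (simp add: d_def)
  have "summable d"
  proof (rule summable_comparison_test'[of _ 0])
    show "summable (\<lambda>i. D * r ^ i)" using sums_summable[OF geo[of 0]] by simp
  qed (rule d)
  define z where "z = u 0 + suminf d"
  have tail: "norm (z - u j) \<le> D * (r ^ j / (1 - r))" for j
  proof -
    have "(\<Sum>i<j. d i) = u j - u 0"
      unfolding d_def by (rule sum_lessThan_telescope)
    then have "z - u j = (\<Sum>i. d (i + j))"
      using suminf_minus_initial_segment[OF \<open>summable d\<close>, of j] by (simp add: z_def)
    also have "norm \<dots> \<le> (\<Sum>i. D * r ^ (i + j))"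
      by (rule norm_suminf_le[OF d sums_summable[OF geo]])
    also have "\<dots> = D * (r ^ j / (1 - r))"
      using geo[of j] by (rule sums_unique[symmetric])
    finally show ?thesis .
  qed
  \<comment> \<open>On \<open>F j\<close> the term added at stage \<open>j\<close> outweighs everything before and after it.\<close>
  have z_large: "r ^ j / 2 \<le> apply_bcontfun (Q z) n" if n: "n \<in> F j" for j n
  proof -
    have "z = u j + (u (Suc j) - u j) + (z - u (Suc j))" by simp
    then have "Q z = Q (u j) + Q (u (Suc j) - u j) + Q (z - u (Suc j))"
      by (metis Q.add)
    then have "apply_bcontfun (Q z) n = apply_bcontfun (Q (u j)) n
        + apply_bcontfun (Q (u (Suc j) - u j)) n + apply_bcontfun (Q (z - u (Suc j))) n"
      by (simp add: plus_bcontfun.rep_eq)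
    moreover have "\<bar>apply_bcontfun (Q (u j)) n\<bar> \<le> r ^ j / 4"
      using u_early F(2)[of j] n by auto
    moreover have "r ^ j \<le> apply_bcontfun (Q (u (Suc j) - u j)) n"
      by (rule F(4)[OF n])
    moreover have "\<bar>apply_bcontfun (Q (z - u (Suc j))) n\<bar> \<le> r ^ j / 4"
    proof -
      have "\<bar>apply_bcontfun (Q (z - u (Suc j))) n\<bar> \<le> norm (z - u (Suc j)) * C"
        by (rule coord_bound)
      also have "\<dots> \<le> D * (r ^ Suc j / (1 - r)) * C"
        using tail[of "Suc j"] C(1) by (intro mult_right_mono) auto
      also have "\<dots> = r ^ j * (C * (D * (r / (1 - r))))"
        by (simp add: mult_ac)
      also have "\<dots> \<le> r ^ j * (1 / 4)"
        using r_tail r by (intro mult_left_mono) auto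
      finally show ?thesis by simp
    qed
    ultimately show ?thesis by linarith
  qed

  have "\<exists>h. bij_betw h (B j) (F j)" for j
    using finite_same_card_bij[OF B F(1)] F(3) by simp
  then obtain h where h: "\<And>j. bij_betw (h j) (B j) (F j)"
    by metis
  \<comment> \<open>The sets \<open>B j\<close> increase with \<open>j\<close>; entry \<open>k\<close> goes to the first block that admits it,
     where its size is at most \<open>r ^ l k / 2\<close>. For block \<open>0\<close> this is the bound on \<open>norm y\<close>.\<close>
  define l where "l k = (LEAST j. k \<in> B j)" for k
  define p where "p k = h (l k) k" for k
  have l: "k \<in> B (l k)" "\<bar>apply_bcontfun y k\<bar> \<le> r ^ l k / 2" if k: "apply_bcontfun y k \<noteq> 0" for k
  proof -
    obtain j where "r ^ j < \<bar>apply_bcontfun y k\<bar>"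
      using real_arch_pow_inv[of "\<bar>apply_bcontfun y k\<bar>" r] k r by auto
    moreover have "r ^ Suc j / 2 \<le> r ^ j"
    proof -
      have "r ^ Suc j \<le> 1 * r ^ j"
        using r unfolding power_Suc by (intro mult_right_mono) auto
      moreover have "0 \<le> r ^ j" using r by simp
      ultimately show ?thesis by linarith
    qed
    ultimately have "k \<in> B j" by (simp add: B_def)
    then show "k \<in> B (l k)" unfolding l_def by (rule LeastI)
    show "\<bar>apply_bcontfun y k\<bar> \<le> r ^ l k / 2"
    proof (cases "l k")
      case 0
      then show ?thesis using norm_bounded[of y k] y(2) by simp
    next
      case (Suc i)
      then have "k \<notin> B i" unfolding l_def by (intro not_less_Least) simp
      then show ?thesis using Suc by (simp add: B_def)
    qed
  qed
  have p: "p k \<in> F (l k)" if "apply_bcontfun y k \<noteq> 0" for k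
    unfolding p_def using h l(1)[OF that] by (auto dest: bij_betwE)
  show ?thesis
  proof (rule that)
    show "inj_on p {k. apply_bcontfun y k \<noteq> 0}"
    proof (rule inj_onI)
      fix k k' assume k: "k \<in> {k. apply_bcontfun y k \<noteq> 0}" "k' \<in> {k. apply_bcontfun y k \<noteq> 0}"
        and eq: "p k = p k'"
      then have same: "l k = l k'"
        using p[of k] p[of k'] by (intro F_disj) auto
      have "k \<in> B (l k)" "k' \<in> B (l k)"
        using l(1)[of k] l(1)[of k'] k same by auto
      then show "k = k'"
        using eq h[of "l k"] same by (auto simp: p_def bij_betw_def dest: inj_onD)
    qed
    show "\<bar>apply_bcontfun y k\<bar> \<le> \<bar>apply_bcontfun (Q z) (p k)\<bar>" if "apply_bcontfun y k \<noteq> 0" for k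
      using l(2)[OF that] z_large[OF p[OF that]] by linarith
  qed
qed

section \<open>The coordinate functionals are not norm null\<close>

text \<open>
  The ideal contains all unit vectors. A rapidly convergent series of their preimages gives an element \<open>(c k)\<close> of \<open>E\<close> with no zero entry. If
  the norms of the coordinate functionals tended to \<open>0\<close>, one could choose positions
  \<open>\<phi> k\<close> where they fall below \<open>c k / (k + 1)\<close>. Moving \<open>c k\<close> to position
  \<open>\<phi> k\<close> gives an element of \<open>E\<close>, but it is too large at these positions to be the
  image of any vector.
\<close>

lemma coordinate_functionals_not_null:
  fixes Q :: "'z::banach \<Rightarrow> bseq" and x :: "nat \<Rightarrow> 'z \<Rightarrow>\<^sub>L real"
  assumes E: "symmetric_sequence_ideal E" "E \<noteq> {0}" and onto: "range Q = E"
    and x: "\<And>n z. blinfun_apply (x n) z = apply_bcontfun (Q z) n"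
  shows "\<not> x \<longlonglongrightarrow> 0"
proof
  assume null: "x \<longlonglongrightarrow> 0"
  have "\<exists>w. \<forall>k. blinfun_apply (x k) w = (if k = n then 1 else 0)" for n
  proof -
    obtain v where v: "v \<in> E" "apply_bcontfun v = (\<lambda>k. if k = n then 1 else 0)"
      by (rule unit_vector_in_symmetric_sequence_ideal[OF E])
    then obtain w where "v = Q w" using onto by blast
    with v(2) show ?thesis by (intro exI[of _ w]) (simp add: x)
  qed
  then obtain w where w: "\<And>n k. blinfun_apply (x k) (w n) = (if k = n then 1 else 0)"
    by metis
  define c where "c n = (1 / 2) ^ n / (1 + norm (w n))" for n
  have c: "0 < c n" "c n \<le> (1 / 2) ^ n" "norm (c n *\<^sub>R w n) \<le> (1 / 2) ^ n" for n
  proof -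
    have pos: "0 < 1 + norm (w n)" using norm_ge_zero[of "w n"] by linarith
    show "0 < c n" using pos by (simp add: c_def)
    show "c n \<le> (1 / 2) ^ n"
      using pos by (simp add: c_def divide_le_eq mult_le_cancel_left1)
    show "norm (c n *\<^sub>R w n) \<le> (1 / 2) ^ n"
      using pos by (simp add: c_def divide_le_eq)
  qed
  have sum: "summable (\<lambda>n. c n *\<^sub>R w n)"
  proof (rule summable_comparison_test'[of _ 0])
    show "summable (\<lambda>n. (1 / 2 :: real) ^ n)" by (rule summable_geometric) simp
  qed (rule c(3))
  define z where "z = (\<Sum>n. c n *\<^sub>R w n)"
  have z: "apply_bcontfun (Q z) k = c k" for k
  proof -
    have "(\<lambda>n. blinfun_apply (x k) (c n *\<^sub>R w n)) sums blinfun_apply (x k) z"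
      unfolding z_def
      by (rule bounded_linear.sums[OF blinfun.bounded_linear_right summable_sums[OF sum]])
    moreover have "(\<lambda>n. blinfun_apply (x k) (c n *\<^sub>R w n)) = (\<lambda>n. if n = k then c n else 0)"
      by (auto simp: blinfun.scaleR_right w)
    ultimately have "blinfun_apply (x k) z = c k"
      using sums_unique2 sums_single[of k c] by metis
    then show ?thesis by (simp add: x)
  qed
  have "\<exists>\<phi>. \<forall>k. norm (x (\<phi> k)) < c k / Suc k \<and> \<phi> k < \<phi> (Suc k)"
  proof (rule dependent_nat_choice)
    have ev: "\<forall>\<^sub>F n in sequentially. norm (x n) < c k / Suc k" for k
      using null c(1)[of k] by (auto simp: tendsto_iff dist_norm)
    show "\<exists>n. norm (x n) < c 0 / Suc 0"
      using eventually_happens[OF ev[of 0]] by simp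
    show "\<exists>n. norm (x n) < c (Suc k) / Suc (Suc k) \<and> m < n" for m k
      using eventually_happens[OF eventually_conj[OF ev[of "Suc k"] eventually_gt_at_top[of m]]]
      by simp
  qed
  then obtain \<phi> where \<phi>: "\<And>k. norm (x (\<phi> k)) < c k / Suc k" "strict_mono \<phi>"
    using strict_mono_Suc_iff by blast
  have inj: "inj \<phi>" using \<phi>(2) by (rule strict_mono_imp_inj_on)
  define b where "b n = (if n \<in> range \<phi> then c (inv \<phi> n) else 0)" for n
  have b: "b (\<phi> k) = c k" for k
    using inj by (simp add: b_def)
  have "b \<longlonglongrightarrow> 0"
    unfolding tendsto_iff cofinite_eq_sequentially[symmetric] eventually_cofinite
  proof (intro allI impI)
    fix e :: real assume "e > 0"
    have "c \<longlonglongrightarrow> 0"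
      using c(1,2) by (intro tendsto_sandwich[OF _ _ tendsto_const LIMSEQ_realpow_zero[of "1/2"]])
        (auto intro!: always_eventually less_imp_le)
    then have "finite {k. e \<le> c k}"
      using \<open>e > 0\<close> c(1) less_imp_le[OF c(1)]
      by (simp add: tendsto_iff cofinite_eq_sequentially[symmetric] eventually_cofinite not_less)
    then have "finite (\<phi> ` {k. e \<le> c k})" by simp
    moreover have "{n. \<not> dist (b n) 0 < e} \<subseteq> \<phi> ` {k. e \<le> c k}"
    proof
      fix n assume "n \<in> {n. \<not> dist (b n) 0 < e}"
      then have n: "e \<le> \<bar>b n\<bar>" by simp
      with \<open>e > 0\<close> have "n \<in> range \<phi>" by (auto simp: b_def split: if_splits)
      then obtain k where k: "n = \<phi> k" by blast
      with n c(1)[of k] have "e \<le> c k" by (simp add: b)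
      with k show "n \<in> \<phi> ` {k. e \<le> c k}" by blast
    qed
    ultimately show "finite {n. \<not> dist (b n) 0 < e}"
      by (rule rev_finite_subset)
  qed
  then obtain y where y: "y \<in> c0" "apply_bcontfun y = b"
    by (rule c0_of_tendsto)
  have supp: "{n. apply_bcontfun y n \<noteq> 0} \<subseteq> range \<phi>"
    by (auto simp: y(2) b_def split: if_splits)
  have "y \<in> E"
  proof (rule symmetric_sequence_ideal_inj_on[OF E(1) _ y(1)])
    show "Q z \<in> E" using onto by blast
    show "inj_on (inv \<phi>) {n. apply_bcontfun y n \<noteq> 0}"
      by (rule inj_on_inv_into[OF supp])
    show "\<bar>apply_bcontfun y n\<bar> \<le> \<bar>apply_bcontfun (Q z) (inv \<phi> n)\<bar>"
      if "apply_bcontfun y n \<noteq> 0" for n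
      by (auto simp: y(2) b_def z)
  qed
  then obtain v where v: "y = Q v" using onto by blast
  have "real (Suc k) \<le> norm v" for k
  proof -
    have "c k = blinfun_apply (x (\<phi> k)) v"
      using b[of k] by (simp add: x v[symmetric] y(2))
    also have "\<dots> \<le> norm (x (\<phi> k)) * norm v"
      using norm_blinfun[of "x (\<phi> k)" v] by simp
    also have "\<dots> \<le> c k / Suc k * norm v"
      using \<phi>(1)[of k] by (intro mult_right_mono) auto
    finally have "c k * real (Suc k) \<le> c k * norm v"
      by (simp add: field_simps)
    then show ?thesis using c(1)[of k] by simp
  qed
  moreover obtain k where "norm v < real k"
    using reals_Archimedean2 by blast
  ultimately show False
    by (metis lessI less_imp_of_nat_less not_le order.strict_trans)
qed

section \<open>The ideal is all of \<open>c0\<close>\<close>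

theorem theorem3p1:
  fixes E :: "bseq set"
    and N :: "bseq \<Rightarrow> real"
    and Q :: "'z::banach \<Rightarrow> bseq"
    and M :: "('z \<Rightarrow>\<^sub>L real) set"
  assumes "symmetric_sequence_ideal E" and "E \<noteq> {0}"
    and "banach_norm_on E N"
    and "continuous_inclusion E N"
    and "bounded_linear_onto Q E N"
    and "subspace M" and "closed M" and "schur_property M"
    and "\<And>n. dual_adjoint Q (coord n) \<in> M"
  shows "E = c0"
proof -
  have sub: "subspace E" and E_c0: "E \<subseteq> c0"
    using assms(1) by (auto simp: symmetric_sequence_ideal_def)
  have N: "norm_on E N"
    using assms(3) by (simp add: banach_norm_on_def)
  obtain K where K: "0 < K" "\<And>v. v \<in> E \<Longrightarrow> norm v \<le> K * N v"
    using continuous_inclusion_bounded[OF sub N assms(4)] by blast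
  obtain L where lin: "linear Q" and onto: "range Q = E" and L: "\<And>z. N (Q z) \<le> L * norm z"
    using assms(5) by (auto simp: bounded_linear_onto_def)
  have Q: "bounded_linear Q"
    unfolding bounded_linear_def bounded_linear_axioms_def
  proof (intro conjI lin exI[of _ "K * L"] allI)
    fix z
    have "norm (Q z) \<le> K * N (Q z)" using K(2) onto by blast
    also have "\<dots> \<le> K * (L * norm z)" using L K(1) by (intro mult_left_mono) auto
    finally show "norm (Q z) \<le> norm z * (K * L)" by (simp add: mult_ac)
  qed
  have range: "Q z \<in> c0" for z
    using onto E_c0 by blast
  define x where "x n = dual_adjoint Q (coord n)" for n
  have x: "blinfun_apply (x n) z = apply_bcontfun (Q z) n" for n z
  proof -
    have "bounded_linear (\<lambda>v :: bseq. apply_bcontfun v n)"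
    proof (rule bounded_linear_intro[where K = 1])
      show "norm (apply_bcontfun v n) \<le> norm v * 1" for v :: bseq
        using norm_bounded[of v n] by simp
    qed (simp_all add: plus_bcontfun.rep_eq)
    then have "bounded_linear (coord n \<circ> Q)"
      using bounded_linear_compose[OF _ Q] by (simp add: coord_def comp_def)
    then show ?thesis
      by (simp add: x_def dual_adjoint_def bounded_linear_Blinfun_apply coord_def)
  qed
  have xM: "x n \<in> M" for n
    using assms(9) by (simp add: x_def)
  \<comment> \<open>Here the Schur property enters: the sequence is not weakly null.\<close>
  have "\<exists>f\<in>bounded_functionals_on M. \<not> (\<lambda>n. f (x n)) \<longlonglongrightarrow> 0"
  proof (rule ccontr)
    assume "\<not> ?thesis"
    then have null: "(\<lambda>n. f (x n)) \<longlonglongrightarrow> f 0" if "f \<in> bounded_functionals_on M" for f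
      using bounded_functionals_on_sum[OF that assms(6), of "{}"] that by simp
    have "weakly_converges_in M x 0"
      using xM subspace_0[OF assms(6)] null by (auto simp: weakly_converges_in_def)
    then obtain y where y: "x \<longlonglongrightarrow> y"
      using assms(8) by (auto simp: schur_property_def)
    have "blinfun_apply y z = 0" for z
    proof (rule LIMSEQ_unique)
      show "(\<lambda>n. blinfun_apply (x n) z) \<longlonglongrightarrow> blinfun_apply y z"
        using y by (intro tendsto_intros)
      show "(\<lambda>n. blinfun_apply (x n) z) \<longlonglongrightarrow> 0"
        using range[of z] by (simp add: x c0_def)
    qed
    then have "y = 0" by (intro blinfun_eqI) simp
    with y coordinate_functionals_not_null[OF assms(1,2) onto x] show False by simp
  qed
  then obtain f where f: "f \<in> bounded_functionals_on M" "\<not> (\<lambda>n. f (x n)) \<longlonglongrightarrow> 0"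
    by blast
  obtain A D where A: "infinite A"
    "\<And>F. finite F \<Longrightarrow> F \<subseteq> A \<Longrightarrow> \<exists>z. norm z \<le> D \<and> (\<forall>n\<in>F. 1 \<le> blinfun_apply (x n) z)"
    using uniformly_large_on_infinite_set[OF assms(6) xM f] by blast
  have "y \<in> E" if y: "y \<in> c0" for y
  proof -
    \<comment> \<open>A scaling that brings the norm of \<open>y\<close> down to at most \<open>1 / 2\<close>.\<close>
    define a where "a = 1 / (2 * (norm y + 1))"
    have a: "a > 0"
      using norm_ge_zero[of y] by (simp add: a_def add_nonneg_pos)
    have ay: "a *\<^sub>R y \<in> c0"
      using y tendsto_mult_right_zero[of "apply_bcontfun y" sequentially a]
      by (simp add: c0_def)
    have "norm (a *\<^sub>R y) \<le> a * (norm y + 1)"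
      using a by simp
    also have "\<dots> = 1 / 2"
      using norm_ge_zero[of y] by (simp add: a_def add_nonneg_eq_0_iff)
    finally obtain z p where
      "inj_on p {k. apply_bcontfun (a *\<^sub>R y) k \<noteq> 0}"
      "\<And>k. apply_bcontfun (a *\<^sub>R y) k \<noteq> 0 \<Longrightarrow>
        \<bar>apply_bcontfun (a *\<^sub>R y) k\<bar> \<le> \<bar>apply_bcontfun (Q z) (p k)\<bar>"
      using gliding_hump_domination[OF Q range A(1) A(2)[unfolded x] ay] by blast
    then have "a *\<^sub>R y \<in> E"
      using symmetric_sequence_ideal_inj_on[OF assms(1) _ ay, of "Q z" p] onto by blast
    then have "(1 / a) *\<^sub>R (a *\<^sub>R y) \<in> E"
      by (rule subspace_scale[OF sub])
    then show ?thesis using a by simp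
  qed
  with E_c0 show ?thesis by blast
qed

end
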